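(* Let $n\ge1$, let $\alpha\in\mathcal{T}_n$ be an idempotent of rank $l$, and consider the variant $(\mathcal{T}_n,* )$ with $\beta*\gamma=\beta\alpha\gamma$. Then: (a) $\mathcal{T}_n^{(l)}$ is a subsemigroup of $(\mathcal{T}_n,* )$. (b) The decomposition $\mathcal{T}_n^{(l)}=\bigcup_{(\Lambda,I)\in\mathcal{X}\times\mathcal{Y}}\sqrt{\varepsilon(\Lambda,I)}$ into a disjoint union of subsets defines a congruence on $\mathcal{T}_n^{(l)}$, the quotient modulo which is isomorphic to the rectangular band $\mathcal{X}\times\mathcal{Y}$. (c) Let $\psi:\mathcal{T}_n^{(l)}\to\mathcal{X}\times\mathcal{Y}$ be the natural projection given by (b) (sending every element of $\sqrt{\varepsilon(\Lambda,I)}$ to $(\Lambda,I)$). Then taking preimages under $\psi$ induces a bijection between the set of all subsemigroups of $\mathcal{X}\times\mathcal{Y}$ and the set $\mathfrak{I}(\mathcal{T}_n^{(l)})$ of all isolated subsemigroups of $\mathcal{T}_n^{(l)}$. (d) $|\mathfrak{I}(\mathcal{T}_n^{(l)})|=2^{|\mathcal{X}|+|\mathcal{Y}|}-2^{|\mathcal{X}|}-2^{|\mathcal{Y}|}+1$.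
   Context: Subsemigroups are non-empty. A subsemigroup $T$ of a semigroup $S$ is isolated if for all $x\in S$: $x^j\in T$ for some $j>0$ implies $x\in T$. $N=\{1,\dots,n\}$; $\mathcal{T}_n$ is the set of all maps $N\to N$, composed from left to right: $(\beta\gamma)(x)=\gamma(\beta(x))$. $\operatorname{im}(\beta)$ is the image of $\beta$, $\operatorname{rank}(\beta)=|\operatorname{im}(\beta)|$, and $\Lambda_\beta$ is the kernel of $\beta$: the equivalence relation (partition of $N$) $x\,\Lambda_\beta\, y\iff\beta(x)=\beta(y)$. $\alpha\in\mathcal{T}_n$ is an idempotent ($\alpha\alpha=\alpha$) of rank $l$ with kernel blocks $A_1,\dots,A_l$ and image $A=\{a_1,\dots,a_l\}$, where $\alpha(A_i)=\{a_i\}$, so $a_i\in A_i$. The variant $(\mathcal{T}_n,* )$ has operation $\beta*\gamma=\beta\alpha\gamma$; all idempotents and powers are taken with respect to $*$. For an idempotent $\varepsilon$ of $(\mathcal{T}_n,* )$, $\sqrt{\varepsilon}$ is the set of all $\beta$ some $*$-power of which equals $\varepsilon$. For $\beta\in\mathcal{T}_n$ let $\varepsilon$ be the unique idempotent in the cyclic subsemigroup of $(\mathcal{T}_n,* )$ generated by $\beta$; the stable rank of $\beta$ is $\operatorname{rank}(\varepsilon)$. It is at most $l$. $\mathcal{T}_n^{(l)}$ is the set of elements of stable rank $l$. $\mathcal{X}$ is the set of all partitions of $N$ into $l$ blocks such that $a_1,\dots,a_l$ lie in different blocks. $\mathcal{Y}$ is the set of all sets $\{b_1,\dots,b_l\}$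 with $b_i\in A_i$ for all $i$. For $\Lambda\in\mathcal{X}$, $I\in\mathcal{Y}$, $\varepsilon(\Lambda,I)$ is the unique idempotent of $(\mathcal{T}_n,* )$ with kernel $\Lambda$ and image $I$. The rectangular band $\mathcal{X}\times\mathcal{Y}$ has multiplication $(\Lambda,I)(\Lambda',I')=(\Lambda,I')$. *)

theory Defs
  imports Main "HOL-Library.FuncSet" "HOL-Library.Disjoint_Sets"
begin

text \<open>
  A semigroup is given by a carrier set together with a binary operation; the operation is
  only looked at on the carrier. Subsemigroups are non-empty.
\<close>

definition subsemigroup :: "'a set \<Rightarrow> ('a \<Rightarrow> 'a \<Rightarrow> 'a) \<Rightarrow> 'a set \<Rightarrow> bool" where
  "subsemigroup S m T \<longleftrightarrow> T \<noteq> {} \<and> T \<subseteq> S \<and> (\<forall>x\<in>T. \<forall>y\<in>T. m x y \<in> T)"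

text \<open>
  The power \<open>x\<^sup>j\<close> with respect to \<open>m\<close>. There need not be a unit, so this is meaningful for
  \<open>j > 0\<close> only, and it is only used for such \<open>j\<close>.
\<close>

definition spower :: "('a \<Rightarrow> 'a \<Rightarrow> 'a) \<Rightarrow> 'a \<Rightarrow> nat \<Rightarrow> 'a" where
  "spower m x j = ((\<lambda>y. m y x) ^^ (j - 1)) x"

definition isolated_subsemigroup :: "'a set \<Rightarrow> ('a \<Rightarrow> 'a \<Rightarrow> 'a) \<Rightarrow> 'a set \<Rightarrow> bool" where
  "isolated_subsemigroup S m T \<longleftrightarrow>
     subsemigroup S m T \<and> (\<forall>x\<in>S. (\<exists>j>0. spower m x j \<in> T) \<longrightarrow> x \<in> T)"

definition cyclic_subsemigroup :: "('a \<Rightarrow> 'a \<Rightarrow> 'a) \<Rightarrow> 'a \<Rightarrow> 'a set" where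
  "cyclic_subsemigroup m x = {spower m x j |j. j > 0}"

definition congruence_on :: "'a set \<Rightarrow> ('a \<Rightarrow> 'a \<Rightarrow> 'a) \<Rightarrow> ('a \<times> 'a) set \<Rightarrow> bool" where
  "congruence_on S m r \<longleftrightarrow>
     equiv S r \<and> (\<forall>(x, x')\<in>r. \<forall>(y, y')\<in>r. (m x y, m x' y') \<in> r)"

text \<open>
  The operation on the quotient \<open>S // r\<close>; for a congruence \<open>r\<close> the union ranges over one and
  the same class, namely that of the product of any two representatives.
\<close>

definition quotient_mult ::
    "('a \<Rightarrow> 'a \<Rightarrow> 'a) \<Rightarrow> ('a \<times> 'a) set \<Rightarrow> 'a set \<Rightarrow> 'a set \<Rightarrow> 'a set" where
  "quotient_mult m r C D = (\<Union>x\<in>C. \<Union>y\<in>D. r `` {m x y})"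

definition semigroup_isomorphic ::
    "'a set \<Rightarrow> ('a \<Rightarrow> 'a \<Rightarrow> 'a) \<Rightarrow> 'b set \<Rightarrow> ('b \<Rightarrow> 'b \<Rightarrow> 'b) \<Rightarrow> bool" where
  "semigroup_isomorphic S m S' m' \<longleftrightarrow>
     (\<exists>f. bij_betw f S S' \<and> (\<forall>x\<in>S. \<forall>y\<in>S. f (m x y) = m' (f x) (f y)))"

definition rect_mult :: "'a \<times> 'b \<Rightarrow> 'a \<times> 'b \<Rightarrow> 'a \<times> 'b" where
  "rect_mult p q = (fst p, snd q)"


text \<open>
  Transformations of \<open>{1..n}\<close> are extensional functions. They are composed from left to right,
  whereas \<^const>\<open>compose\<close> composes from right to left.
\<close>

definition transformations :: "nat \<Rightarrow> (nat \<Rightarrow> nat) set" where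
  "transformations n = {1..n} \<rightarrow>\<^sub>E {1..n}"

definition tmult :: "nat \<Rightarrow> (nat \<Rightarrow> nat) \<Rightarrow> (nat \<Rightarrow> nat) \<Rightarrow> nat \<Rightarrow> nat" where
  "tmult n \<beta> \<gamma> = compose {1..n} \<gamma> \<beta>"

definition variant_mult ::
    "nat \<Rightarrow> (nat \<Rightarrow> nat) \<Rightarrow> (nat \<Rightarrow> nat) \<Rightarrow> (nat \<Rightarrow> nat) \<Rightarrow> nat \<Rightarrow> nat" where
  "variant_mult n \<alpha> \<beta> \<gamma> = tmult n (tmult n \<beta> \<alpha>) \<gamma>"

definition im :: "nat \<Rightarrow> (nat \<Rightarrow> nat) \<Rightarrow> nat set" where
  "im n \<beta> = \<beta> ` {1..n}"

definition rank :: "nat \<Rightarrow> (nat \<Rightarrow> nat) \<Rightarrow> nat" where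
  "rank n \<beta> = card (im n \<beta>)"

text \<open>The kernel, viewed as a partition of \<open>{1..n}\<close>, i.e. as the set of its blocks.\<close>

definition ker_partition :: "nat \<Rightarrow> (nat \<Rightarrow> nat) \<Rightarrow> nat set set" where
  "ker_partition n \<beta> = {1..n} // {(x, y). x \<in> {1..n} \<and> y \<in> {1..n} \<and> \<beta> x = \<beta> y}"

definition variant_idempotent :: "nat \<Rightarrow> (nat \<Rightarrow> nat) \<Rightarrow> (nat \<Rightarrow> nat) \<Rightarrow> bool" where
  "variant_idempotent n \<alpha> \<epsilon> \<longleftrightarrow> \<epsilon> \<in> transformations n \<and> variant_mult n \<alpha> \<epsilon> \<epsilon> = \<epsilon>"

definition variant_sqrt :: "nat \<Rightarrow> (nat \<Rightarrow> nat) \<Rightarrow> (nat \<Rightarrow> nat) \<Rightarrow> (nat \<Rightarrow> nat) set" where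
  "variant_sqrt n \<alpha> \<epsilon> =
     {\<beta> \<in> transformations n. \<exists>j>0. spower (variant_mult n \<alpha>) \<beta> j = \<epsilon>}"

text \<open>
  The idempotent in the description below exists and is unique, since the semigroup is finite.
\<close>

definition stable_rank :: "nat \<Rightarrow> (nat \<Rightarrow> nat) \<Rightarrow> (nat \<Rightarrow> nat) \<Rightarrow> nat" where
  "stable_rank n \<alpha> \<beta> =
     rank n (THE \<epsilon>. \<epsilon> \<in> cyclic_subsemigroup (variant_mult n \<alpha>) \<beta> \<and> variant_idempotent n \<alpha> \<epsilon>)"

definition stable_rank_set :: "nat \<Rightarrow> (nat \<Rightarrow> nat) \<Rightarrow> nat \<Rightarrow> (nat \<Rightarrow> nat) set" where
  "stable_rank_set n \<alpha> l = {\<beta> \<in> transformations n. stable_rank n \<alpha> \<beta> = l}"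

definition XX :: "nat \<Rightarrow> (nat \<Rightarrow> nat) \<Rightarrow> nat \<Rightarrow> nat set set set" where
  "XX n \<alpha> l =
     {P. partition_on {1..n} P \<and> card P = l \<and>
         (\<forall>a\<in>im n \<alpha>. \<forall>a'\<in>im n \<alpha>. a \<noteq> a' \<longrightarrow> \<not> (\<exists>B\<in>P. a \<in> B \<and> a' \<in> B))}"

text \<open>
  The kernel blocks of \<open>\<alpha>\<close> serve as their own indices: \<open>b\<close> picks one point from each block.
\<close>

definition YY :: "nat \<Rightarrow> (nat \<Rightarrow> nat) \<Rightarrow> nat set set" where
  "YY n \<alpha> = {b ` ker_partition n \<alpha> |b. \<forall>B\<in>ker_partition n \<alpha>. b B \<in> B}"

text \<open>
  The idempotent with given kernel and image; it exists and is unique whenever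
  \<open>\<alpha>\<close> is an idempotent of rank \<open>l\<close>, \<open>\<Lambda> \<in> XX n \<alpha> l\<close> and \<open>I \<in> YY n \<alpha>\<close>.
\<close>

definition idem :: "nat \<Rightarrow> (nat \<Rightarrow> nat) \<Rightarrow> nat set set \<Rightarrow> nat set \<Rightarrow> nat \<Rightarrow> nat" where
  "idem n \<alpha> \<Lambda> I =
     (THE \<epsilon>. variant_idempotent n \<alpha> \<epsilon> \<and> ker_partition n \<epsilon> = \<Lambda> \<and> im n \<epsilon> = I)"

definition root_class :: "nat \<Rightarrow> (nat \<Rightarrow> nat) \<Rightarrow> nat set set \<times> nat set \<Rightarrow> (nat \<Rightarrow> nat) set" where
  "root_class n \<alpha> p = variant_sqrt n \<alpha> (idem n \<alpha> (fst p) (snd p))"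

definition root_rel ::
    "nat \<Rightarrow> (nat \<Rightarrow> nat) \<Rightarrow> nat \<Rightarrow> ((nat \<Rightarrow> nat) \<times> (nat \<Rightarrow> nat)) set" where
  "root_rel n \<alpha> l =
     {(\<beta>, \<gamma>). \<exists>p \<in> XX n \<alpha> l \<times> YY n \<alpha>. \<beta> \<in> root_class n \<alpha> p \<and> \<gamma> \<in> root_class n \<alpha> p}"

definition natural_proj ::
    "nat \<Rightarrow> (nat \<Rightarrow> nat) \<Rightarrow> nat \<Rightarrow> (nat \<Rightarrow> nat) \<Rightarrow> nat set set \<times> nat set" where
  "natural_proj n \<alpha> l \<beta> = (THE p. p \<in> XX n \<alpha> l \<times> YY n \<alpha> \<and> \<beta> \<in> root_class n \<alpha> p)"

definition isolated_subsemigroups :: "'a set \<Rightarrow> ('a \<Rightarrow> 'a \<Rightarrow> 'a) \<Rightarrow> 'a set set" where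
  "isolated_subsemigroups S m = {T. isolated_subsemigroup S m T}"

end

theory Submission
  imports Defs
begin

text \<open>
  Let \<open>A\<close> be the image of \<open>\<alpha>\<close>. A map \<open>\<beta>\<close> has stable rank \<open>l\<close> iff \<open>\<alpha> \<circ> \<beta>\<close> permutes \<open>A\<close>, because
  the \<open>j\<close>-th power of \<open>\<beta>\<close> in the variant becomes \<open>(\<alpha> \<circ> \<beta>) ^^ j\<close> after composition with \<open>\<alpha>\<close>.
  On these maps, \<open>\<beta> \<mapsto> (kernel of \<alpha> \<circ> \<beta>, \<beta> ` A)\<close> is a surjective homomorphism onto the
  rectangular band, and an idempotent is determined by its value, which is its kernel and its
  image. So the classes \<open>\<surd>\<epsilon>(\<Lambda>, I)\<close> are the fibres of this homomorphism. An isolated subsemigroup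
  that meets a fibre contains the idempotent of the fibre, hence the whole fibre.
\<close>

section \<open>Powers in finite semigroups\<close>

locale carrier_semigroup =
  fixes S :: "'a set" and m :: "'a \<Rightarrow> 'a \<Rightarrow> 'a"
  assumes closed: "x \<in> S \<Longrightarrow> y \<in> S \<Longrightarrow> m x y \<in> S"
    and assoc: "x \<in> S \<Longrightarrow> y \<in> S \<Longrightarrow> z \<in> S \<Longrightarrow> m (m x y) z = m x (m y z)"

lemma spower_1 [simp]: "spower m x (Suc 0) = x"
  by (simp add: spower_def)

lemma spower_Suc: "j > 0 \<Longrightarrow> spower m x (Suc j) = m (spower m x j) x"
  by (cases j) (simp_all add: spower_def)

lemma spower_in_subsemigroup:
  assumes "subsemigroup S m T" "x \<in> T" "j > 0"
  shows "spower m x j \<in> T"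
  using \<open>j > 0\<close>
proof (induction j rule: nat_induct_non_zero)
  case 1
  then show ?case using assms by simp
next
  case (Suc j)
  then show ?case using assms by (simp add: spower_Suc subsemigroup_def)
qed

lemma spower_idempotent:
  assumes "m x x = x" "j > 0"
  shows "spower m x j = x"
  using \<open>j > 0\<close> by (induction j rule: nat_induct_non_zero) (simp_all add: spower_Suc assms)

context carrier_semigroup
begin

lemma spower_closed: "x \<in> S \<Longrightarrow> j > 0 \<Longrightarrow> spower m x j \<in> S"
  by (rule spower_in_subsemigroup[of S]) (auto simp: subsemigroup_def closed)

lemma spower_add:
  assumes "x \<in> S" "i > 0" "j > 0"
  shows "spower m x (i + j) = m (spower m x i) (spower m x j)"
  using \<open>j > 0\<close>
proof (induction j rule: nat_induct_non_zero)
  case 1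
  then show ?case using assms by (simp add: spower_Suc)
next
  case (Suc j)
  then show ?case using assms by (simp add: spower_Suc assoc spower_closed)
qed

lemma spower_mult:
  assumes "x \<in> S" "i > 0" "j > 0"
  shows "spower m (spower m x i) j = spower m x (i * j)"
  using \<open>j > 0\<close>
proof (induction j rule: nat_induct_non_zero)
  case 1
  then show ?case by simp
next
  case (Suc j)
  then have "spower m (spower m x i) (Suc j) = m (spower m x (i * j)) (spower m x i)"
    by (simp add: spower_Suc)
  also have "\<dots> = spower m x (i * j + i)"
    using assms Suc by (simp add: spower_add)
  finally show ?case by (simp add: add.commute)
qed

text \<open>By pigeonhole two powers coincide, so from some index \<open>i\<close> on the powers
  repeat with a period \<open>p\<close>. The exponent \<open>i * p\<close> is past the index and a
  multiple of the period, so doubling it changes nothing.\<close>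

lemma idempotent_spower_exists:
  assumes "finite S" "x \<in> S"
  obtains j where "j > 0" "m (spower m x j) (spower m x j) = spower m x j"
proof -
  have "\<not> inj_on (spower m x) {1..}"
  proof
    assume "inj_on (spower m x) {1..}"
    moreover have "finite (spower m x ` {1..})"
      by (rule finite_subset[OF _ assms(1)]) (use assms in \<open>auto intro: spower_closed\<close>)
    ultimately show False
      using finite_imageD infinite_Ici by blast
  qed
  then obtain i k where ik: "0 < i" "i < k" "spower m x i = spower m x k"
    unfolding inj_on_def by (metis atLeast_iff linorder_neqE_nat not_less_eq_eq One_nat_def not_le)
  define p where "p = k - i"
  have p: "p > 0" "spower m x (i + p) = spower m x i"
    using ik by (simp_all add: p_def)
  \<comment> \<open>The case \<open>t = i\<close> is split off because \<open>spower_add\<close>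
    needs the exponent \<open>t - i\<close> to be positive.\<close>
  have period: "spower m x (t + p) = spower m x t" if "t \<ge> i" for t
  proof (cases "t = i")
    case False
    then have "t - i > 0" using that by simp
    then have "spower m x ((i + p) + (t - i)) = spower m x (i + (t - i))"
      using p ik assms by (simp only: spower_add add_pos_pos)
    then show ?thesis using that by (simp add: add.commute add.left_commute)
  qed (use p in simp)
  have periods: "spower m x (t + q * p) = spower m x t" if "t \<ge> i" for t q
  proof (induction q)
    case (Suc q)
    have "spower m x (t + Suc q * p) = spower m x ((t + q * p) + p)"
      by (simp add: algebra_simps)
    also have "\<dots> = spower m x t" using period[of "t + q * p"] that Suc by simp
    finally show ?case .
  qed simp
  have "i * p \<ge> i" "i * p > 0" using p ik by simp_all
  then have "m (spower m x (i * p)) (spower m x (i * p)) = spower m x (i * p)"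
    using periods[of "i * p" i] assms by (simp add: spower_add)
  then show ?thesis using \<open>i * p > 0\<close> that by blast
qed

text \<open>Both sides equal the power with exponent \<open>i * j\<close>, since powers of an
  idempotent are trivial.\<close>

lemma idempotent_spower_unique:
  assumes "x \<in> S" "i > 0" "j > 0"
    and "m (spower m x i) (spower m x i) = spower m x i"
    and "m (spower m x j) (spower m x j) = spower m x j"
  shows "spower m x i = spower m x j"
proof -
  have "spower m x i = spower m x (i * j)"
    using spower_mult[of x i j] spower_idempotent[of m "spower m x i" j] assms by simp
  also have "\<dots> = spower m x j"
    using spower_mult[of x j i] spower_idempotent[of m "spower m x j" i] assms
    by (simp add: mult.commute)
  finally show ?thesis .
qed

end

section \<open>Homomorphisms onto rectangular bands\<close>

text \<open>From \<open>(u, v)\<close> and \<open>(u', v')\<close> the product yields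
  \<open>(u, v')\<close>, so a closed set is the full product of its two projections.\<close>

lemma subsemigroups_rect_mult:
  "{T. subsemigroup (P \<times> Q) rect_mult T}
    = (\<lambda>(U, V). U \<times> V) ` ((Pow P - {{}}) \<times> (Pow Q - {{}}))"
proof (intro equalityI subsetI)
  fix T assume "T \<in> {T. subsemigroup (P \<times> Q) rect_mult T}"
  then have T: "T \<noteq> {}" "T \<subseteq> P \<times> Q"
    and mult: "\<And>p q. p \<in> T \<Longrightarrow> q \<in> T \<Longrightarrow> rect_mult p q \<in> T"
    by (auto simp: subsemigroup_def)
  have "fst ` T \<times> snd ` T \<subseteq> T"
    using mult by (auto simp: rect_mult_def)
  moreover have "T \<subseteq> fst ` T \<times> snd ` T"
    by force
  ultimately have "T = fst ` T \<times> snd ` T" by blast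
  then have "T = (\<lambda>(U, V). U \<times> V) (fst ` T, snd ` T)"
    unfolding case_prod_conv .
  moreover have "fst ` T \<in> Pow P - {{}}" "snd ` T \<in> Pow Q - {{}}"
    using T by auto
  ultimately show "T \<in> (\<lambda>(U, V). U \<times> V) ` ((Pow P - {{}}) \<times> (Pow Q - {{}}))"
    by (rule image_eqI[OF _ SigmaI])
next
  fix T assume "T \<in> (\<lambda>(U, V). U \<times> V) ` ((Pow P - {{}}) \<times> (Pow Q - {{}}))"
  then obtain U V where "T = U \<times> V" "U \<subseteq> P" "U \<noteq> {}" "V \<subseteq> Q" "V \<noteq> {}"
    by auto
  then show "T \<in> {T. subsemigroup (P \<times> Q) rect_mult T}"
    by (auto simp: subsemigroup_def rect_mult_def)
qed

lemma card_subsemigroups_rect_mult: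
  assumes "finite P" "finite Q"
  shows "int (card {T. subsemigroup (P \<times> Q) rect_mult T})
    = 2 ^ (card P + card Q) - 2 ^ card P - 2 ^ card Q + 1"
proof -
  \<comment> \<open>Empty factors are excluded, as otherwise different pairs could yield the same
    empty product.\<close>
  have "inj_on (\<lambda>(U, V). U \<times> V) ((Pow P - {{}}) \<times> (Pow Q - {{}}))"
    by (auto simp: inj_on_def times_eq_iff)
  then have "card {T. subsemigroup (P \<times> Q) rect_mult T}
      = card (Pow P - {{}}) * card (Pow Q - {{}})"
    by (simp add: subsemigroups_rect_mult card_image card_cartesian_product)
  also have "\<dots> = (2 ^ card P - 1) * (2 ^ card Q - 1)"
    using assms by (simp add: card_Diff_singleton card_Pow)
  finally have "int (card {T. subsemigroup (P \<times> Q) rect_mult T})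
      = (2 ^ card P - 1) * (2 ^ card Q - 1)"
    by (simp add: of_nat_diff)
  then show ?thesis by (simp add: algebra_simps power_add)
qed

text \<open>Finiteness and \<open>surj\<close> put an idempotent into every fibre, and
  \<open>idempotent_unique\<close> makes it the only one there. This rigidity forces isolated
  subsemigroups to be unions of fibres.\<close>

locale rect_band_hom = carrier_semigroup S m
  for S :: "'a set" and m :: "'a \<Rightarrow> 'a \<Rightarrow> 'a" +
  fixes \<phi> :: "'a \<Rightarrow> 'b \<times> 'c" and P :: "'b set" and Q :: "'c set"
  assumes finite_carrier: "finite S"
    and hom: "x \<in> S \<Longrightarrow> y \<in> S \<Longrightarrow> \<phi> (m x y) = rect_mult (\<phi> x) (\<phi> y)"
    and surj: "\<phi> ` S = P \<times> Q"
    and idempotent_unique: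
      "x \<in> S \<Longrightarrow> y \<in> S \<Longrightarrow> m x x = x \<Longrightarrow> m y y = y \<Longrightarrow> \<phi> x = \<phi> y \<Longrightarrow> x = y"
begin

text \<open>Every element of a rectangular band is idempotent, so taking powers never leaves a
  fibre.\<close>

lemma hom_spower:
  assumes "x \<in> S" "j > 0"
  shows "\<phi> (spower m x j) = \<phi> x"
  using \<open>j > 0\<close>
proof (induction j rule: nat_induct_non_zero)
  case (Suc j)
  then show ?case using assms by (simp add: spower_Suc hom spower_closed rect_mult_def)
qed simp

text \<open>Each element has an idempotent power in its own fibre, and the two idempotents in the
  common fibre coincide.\<close>

lemma common_spower:
  assumes "x \<in> S" "y \<in> S" "\<phi> x = \<phi> y"
  obtains i j where "i > 0" "j > 0" "spower m x i = spower m y j"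
proof -
  obtain i where i: "i > 0" "m (spower m x i) (spower m x i) = spower m x i"
    using idempotent_spower_exists[OF finite_carrier assms(1)] .
  obtain j where j: "j > 0" "m (spower m y j) (spower m y j) = spower m y j"
    using idempotent_spower_exists[OF finite_carrier assms(2)] .
  have "spower m x i = spower m y j"
    by (rule idempotent_unique) (simp_all add: i j assms spower_closed hom_spower)
  with i j that show ?thesis by blast
qed

text \<open>The common power of \<open>x\<close> and \<open>y\<close> lies in \<open>T\<close> as a
  power of \<open>x\<close>; isolation then pulls \<open>y\<close> into \<open>T\<close>.\<close>

lemma isolated_saturated:
  assumes "isolated_subsemigroup S m T" "x \<in> T" "y \<in> S" "\<phi> x = \<phi> y"
  shows "y \<in> T"
proof -
  have T: "subsemigroup S m T" using assms by (simp add: isolated_subsemigroup_def)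
  then have "x \<in> S" using assms by (auto simp: subsemigroup_def)
  then obtain i j where "i > 0" "j > 0" "spower m x i = spower m y j"
    using common_spower[OF _ assms(3,4)] by metis
  then have "\<exists>j>0. spower m y j \<in> T"
    using spower_in_subsemigroup[OF T \<open>x \<in> T\<close>] by metis
  then show ?thesis using assms by (auto simp: isolated_subsemigroup_def)
qed

text \<open>Isolation comes for free, because \<open>x\<close> and its powers have the same value
  under \<open>\<phi>\<close>.\<close>

lemma isolated_vimage:
  assumes "subsemigroup (P \<times> Q) rect_mult U"
  shows "isolated_subsemigroup S m (\<phi> -` U \<inter> S)"
proof -
  have "U \<noteq> {}" "U \<subseteq> \<phi> ` S"
    using assms surj by (auto simp: subsemigroup_def)
  then have "\<phi> -` U \<inter> S \<noteq> {}" by blast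
  moreover have "m x y \<in> \<phi> -` U \<inter> S" if "x \<in> \<phi> -` U \<inter> S" "y \<in> \<phi> -` U \<inter> S" for x y
    using that assms by (simp add: subsemigroup_def closed hom)
  ultimately show ?thesis
    using hom_spower by (auto simp: isolated_subsemigroup_def subsemigroup_def)
qed

lemma isolated_image:
  assumes "isolated_subsemigroup S m T"
  shows "subsemigroup (P \<times> Q) rect_mult (\<phi> ` T)"
proof -
  have T: "T \<noteq> {}" "T \<subseteq> S" and mult: "\<And>x y. x \<in> T \<Longrightarrow> y \<in> T \<Longrightarrow> m x y \<in> T"
    using assms by (auto simp: isolated_subsemigroup_def subsemigroup_def)
  have "rect_mult (\<phi> x) (\<phi> y) \<in> \<phi> ` T" if "x \<in> T" "y \<in> T" for x y
    using T mult[OF that] that by (metis hom image_eqI subsetD)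
  moreover have "\<phi> ` T \<subseteq> P \<times> Q"
    using image_mono[OF T(2), of \<phi>] surj by simp
  ultimately show ?thesis
    using T(1) by (simp add: subsemigroup_def)
qed

text \<open>The inverse is the direct image: surjectivity of \<open>\<phi>\<close> gives one
  composition, saturation of isolated subsemigroups the other.\<close>

lemma bij_betw_isolated:
  "bij_betw (\<lambda>U. \<phi> -` U \<inter> S) {U. subsemigroup (P \<times> Q) rect_mult U} (isolated_subsemigroups S m)"
proof (rule bij_betw_byWitness[where f' = "\<lambda>T. \<phi> ` T"])
  show "\<forall>U\<in>{U. subsemigroup (P \<times> Q) rect_mult U}. \<phi> ` (\<phi> -` U \<inter> S) = U"
  proof
    fix U assume "U \<in> {U. subsemigroup (P \<times> Q) rect_mult U}"
    then have "U \<subseteq> \<phi> ` S" by (simp add: subsemigroup_def surj)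
    then show "\<phi> ` (\<phi> -` U \<inter> S) = U" by blast
  qed
  show "\<forall>T\<in>isolated_subsemigroups S m. \<phi> -` \<phi> ` T \<inter> S = T"
  proof
    fix T assume "T \<in> isolated_subsemigroups S m"
    then have T: "isolated_subsemigroup S m T" by (simp add: isolated_subsemigroups_def)
    then have "T \<subseteq> S" by (simp add: isolated_subsemigroup_def subsemigroup_def)
    then show "\<phi> -` \<phi> ` T \<inter> S = T"
      using isolated_saturated[OF T] by fastforce
  qed
next
  show "(\<lambda>U. \<phi> -` U \<inter> S) ` {U. subsemigroup (P \<times> Q) rect_mult U} \<subseteq> isolated_subsemigroups S m"
    unfolding isolated_subsemigroups_def by (intro image_subsetI CollectI isolated_vimage) (rule CollectD)
  show "(\<lambda>T. \<phi> ` T) ` isolated_subsemigroups S m \<subseteq> {U. subsemigroup (P \<times> Q) rect_mult U}"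
    unfolding isolated_subsemigroups_def by (intro image_subsetI CollectI isolated_image) (rule CollectD)
qed

lemma card_isolated_subsemigroups:
  "int (card (isolated_subsemigroups S m)) = 2 ^ (card P + card Q) - 2 ^ card P - 2 ^ card Q + 1"
\<comment> \<open>Finiteness of \<open>P \<times> Q\<close> passes to both factors only if neither
  is empty. With an empty factor the formula evaluates to 0, matching the absence of
  subsemigroups.\<close>
proof (cases "P = {} \<or> Q = {}")
  case True
  then have "S = {}" using surj by auto
  then have "isolated_subsemigroups S m = {}"
    by (auto simp: isolated_subsemigroups_def isolated_subsemigroup_def subsemigroup_def)
  with True show ?thesis
    by auto
next
  case False
  then have "finite P" "finite Q"
    using finite_imageI[OF finite_carrier, of \<phi>] unfolding surj
    by (auto dest: finite_cartesian_productD1 finite_cartesian_productD2)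
  then show ?thesis
    using card_subsemigroups_rect_mult[of P Q] bij_betw_same_card[OF bij_betw_isolated] by simp
qed

section \<open>The congruence of fibres and its quotient\<close>

definition fibre_rel :: "('a \<times> 'a) set" where
  "fibre_rel = {(x, y). x \<in> S \<and> y \<in> S \<and> \<phi> x = \<phi> y}"

lemma equiv_fibre_rel: "equiv S fibre_rel"
  by (rule equivI) (auto simp: fibre_rel_def refl_on_def sym_def trans_def)

lemma congruence_fibre_rel: "congruence_on S m fibre_rel"
  using equiv_fibre_rel by (auto simp: congruence_on_def fibre_rel_def closed hom)

lemma fibre_rel_Image: "x \<in> S \<Longrightarrow> fibre_rel `` {x} = \<phi> -` {\<phi> x} \<inter> S"
  by (auto simp: fibre_rel_def)

text \<open>The value of \<open>\<phi>\<close> at \<open>m x' y'\<close> depends only on the fibres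
  of \<open>x'\<close> and \<open>y'\<close>, so the union in \<open>quotient_mult\<close> repeats a
  single class.\<close>

lemma quotient_mult_fibre_rel:
  assumes "x \<in> S" "y \<in> S"
  shows "quotient_mult m fibre_rel (fibre_rel `` {x}) (fibre_rel `` {y}) = fibre_rel `` {m x y}"
proof -
  have "fibre_rel `` {m x' y'} = fibre_rel `` {m x y}"
    if "x' \<in> fibre_rel `` {x}" "y' \<in> fibre_rel `` {y}" for x' y'
    using that assms by (simp add: fibre_rel_Image closed hom)
  moreover have "x \<in> fibre_rel `` {x}" "y \<in> fibre_rel `` {y}"
    using assms by (simp_all add: fibre_rel_Image)
  ultimately show ?thesis
    unfolding quotient_mult_def by blast
qed

lemma quotient_fibre_rel_isomorphic:
  "semigroup_isomorphic (S // fibre_rel) (quotient_mult m fibre_rel) (P \<times> Q) rect_mult"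
proof -
  \<comment> \<open>On a class \<open>\<phi>\<close> is constant, so the image of \<open>C\<close>
    is a singleton whose element \<open>the_elem\<close> extracts.\<close>
  define f where "f C = the_elem (\<phi> ` C)" for C
  have f: "f (fibre_rel `` {x}) = \<phi> x" if "x \<in> S" for x
  proof -
    have "\<phi> ` (fibre_rel `` {x}) = {\<phi> x}"
      using that by (auto simp: fibre_rel_Image)
    then show ?thesis by (simp add: f_def)
  qed
  have "inj_on f (S // fibre_rel)"
    by (intro inj_onI) (metis f fibre_rel_Image quotientE)
  moreover have "f ` (S // fibre_rel) = P \<times> Q"
    by (simp add: quotient_def UNION_singleton_eq_range image_image f flip: surj)
  moreover have "f (quotient_mult m fibre_rel C D) = rect_mult (f C) (f D)"
    if "C \<in> S // fibre_rel" "D \<in> S // fibre_rel" for C D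
    using that by (auto simp: quotient_mult_fibre_rel f closed hom elim!: quotientE)
  ultimately show ?thesis
    by (auto simp: semigroup_isomorphic_def bij_betw_def)
qed

end

section \<open>Kernel partitions\<close>

lemma equiv_kernel: "equiv {1..n} {(x, y). x \<in> {1..n} \<and> y \<in> {1..n} \<and> f x = f y}"
  by (rule equivI) (auto simp: refl_on_def sym_def trans_def)

lemma partition_on_ker_partition: "partition_on {1..n} (ker_partition n f)"
  unfolding ker_partition_def by (rule partition_on_quotient[OF equiv_kernel])

lemma ker_partition_eq_image: "ker_partition n f = (\<lambda>y. {x \<in> {1..n}. f x = y}) ` f ` {1..n}"
proof -
  have "{(x, y). x \<in> {1..n} \<and> y \<in> {1..n} \<and> f x = f y} `` {x} = {y \<in> {1..n}. f y = f x}"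
    if "x \<in> {1..n}" for x
    using that by auto
  then show ?thesis
    by (simp only: ker_partition_def quotient_def UNION_singleton_eq_range image_image
        cong: image_cong)
qed

lemma inj_on_fibres: "inj_on (\<lambda>y. {x \<in> N. f x = y}) (f ` N)"
  by (auto simp: inj_on_def)

lemma card_ker_partition: "card (ker_partition n f) = card (f ` {1..n})"
  unfolding ker_partition_eq_image by (rule card_image[OF inj_on_fibres])

lemma same_block_ker_partition:
  "(\<exists>B\<in>ker_partition n f. x \<in> B \<and> y \<in> B) \<longleftrightarrow> x \<in> {1..n} \<and> y \<in> {1..n} \<and> f x = f y"
  unfolding ker_partition_eq_image by auto

lemma ker_partition_cong:
  assumes "\<And>x y. x \<in> {1..n} \<Longrightarrow> y \<in> {1..n} \<Longrightarrow> f x = f y \<longleftrightarrow> g x = g y"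
  shows "ker_partition n f = ker_partition n g"
proof -
  have "{(x, y). x \<in> {1..n} \<and> y \<in> {1..n} \<and> f x = f y}
      = {(x, y). x \<in> {1..n} \<and> y \<in> {1..n} \<and> g x = g y}"
    using assms by blast
  then show ?thesis by (simp add: ker_partition_def)
qed

lemma ker_partition_eqD:
  assumes "ker_partition n f = ker_partition n g" "x \<in> {1..n}" "y \<in> {1..n}" "f x = f y"
  shows "g x = g y"
  using same_block_ker_partition[of n f x y] same_block_ker_partition[of n g x y] assms by metis

section \<open>Variants with idempotent sandwich element\<close>

lemma variant_mult_apply:
  "variant_mult n \<alpha> \<beta> \<gamma> x = (if x \<in> {1..n} then \<gamma> (\<alpha> (\<beta> x)) else undefined)"
  by (simp add: variant_mult_def tmult_def compose_def)

locale idempotent_transformation =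
  fixes n :: nat and \<alpha> :: "nat \<Rightarrow> nat"
  assumes \<alpha>_trans: "\<alpha> \<in> transformations n"
    and \<alpha>_idem: "tmult n \<alpha> \<alpha> = \<alpha>"
begin

abbreviation N :: "nat set" where "N \<equiv> {1..n}"
abbreviation A :: "nat set" where "A \<equiv> im n \<alpha>"
abbreviation vm :: "(nat \<Rightarrow> nat) \<Rightarrow> (nat \<Rightarrow> nat) \<Rightarrow> nat \<Rightarrow> nat" where "vm \<equiv> variant_mult n \<alpha>"

text \<open>A description of maximal stable rank that avoids powers;
  \<open>stable_rank_set_eq\<close> proves the agreement.\<close>

definition stable_maps :: "(nat \<Rightarrow> nat) set" where
  "stable_maps = {\<beta> \<in> transformations n. \<alpha> ` \<beta> ` A = A}"

text \<open>The kernel and image of \<open>\<beta>\<close> itself would not do, as a stable map may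
  have rank above \<open>card A\<close>. Composing with \<open>\<alpha>\<close> and restricting to
  \<open>A\<close> cut them down to the right size; for stable idempotents nothing is lost, by
  \<open>coords_idempotent\<close>.\<close>

definition coords :: "(nat \<Rightarrow> nat) \<Rightarrow> nat set set \<times> nat set" where
  "coords \<beta> = (ker_partition n (\<lambda>x. \<alpha> (\<beta> x)), \<beta> ` A)"

section \<open>Elementary properties of the variant\<close>

lemma trans_in: "\<beta> \<in> transformations n \<Longrightarrow> x \<in> N \<Longrightarrow> \<beta> x \<in> N"
  unfolding transformations_def by (rule PiE_mem)

lemma A_subset: "A \<subseteq> N"
  using trans_in[OF \<alpha>_trans] by (auto simp only: im_def)

lemma \<alpha>_in_A: "x \<in> N \<Longrightarrow> \<alpha> x \<in> A"
  by (auto simp: im_def)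

lemma \<alpha>_fixes_A: "a \<in> A \<Longrightarrow> \<alpha> a = a"
proof -
  assume "a \<in> A"
  then obtain x where x: "x \<in> N" "a = \<alpha> x" by (auto simp: im_def)
  have "\<alpha> (\<alpha> x) = tmult n \<alpha> \<alpha> x" using x by (simp add: tmult_def compose_def)
  then show ?thesis using \<alpha>_idem x by simp
qed

lemma finite_A: "finite A"
  by (simp add: im_def)

lemma finite_transformations: "finite (transformations n)"
  by (simp add: transformations_def finite_PiE)

lemma trans_eqI:
  assumes "\<beta> \<in> transformations n" "\<gamma> \<in> transformations n" "\<And>x. x \<in> N \<Longrightarrow> \<beta> x = \<gamma> x"
  shows "\<beta> = \<gamma>"
  using assms unfolding transformations_def by (rule PiE_ext)

lemma variant_closed:
  assumes "\<beta> \<in> transformations n" "\<gamma> \<in> transformations n"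
  shows "vm \<beta> \<gamma> \<in> transformations n"
proof -
  have "\<gamma> (\<alpha> (\<beta> x)) \<in> N" if "x \<in> N" for x
    using that by (intro trans_in[OF assms(2)] trans_in[OF \<alpha>_trans] trans_in[OF assms(1)])
  then show ?thesis
    unfolding transformations_def by (intro PiE_I) (auto simp only: variant_mult_apply if_True if_False)
qed

lemma variant_assoc:
  assumes "\<beta> \<in> transformations n"
  shows "vm (vm \<beta> \<gamma>) \<delta> = vm \<beta> (vm \<gamma> \<delta>)"
  using trans_in[OF \<alpha>_trans trans_in[OF assms]] by (auto simp add: fun_eq_iff variant_mult_apply)

sublocale variant: carrier_semigroup "transformations n" vm
  by unfold_locales (auto simp: variant_closed variant_assoc)

section \<open>Maps permuting the image, and their coordinates\<close>

lemma stable_mapsD: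
  assumes "\<beta> \<in> stable_maps"
  shows "\<beta> \<in> transformations n" "(\<lambda>x. \<alpha> (\<beta> x)) ` A = A" "inj_on (\<lambda>x. \<alpha> (\<beta> x)) A"
    "x \<in> N \<Longrightarrow> \<alpha> (\<beta> x) \<in> A"
proof -
  show "\<beta> \<in> transformations n" and *: "(\<lambda>x. \<alpha> (\<beta> x)) ` A = A"
    using assms by (auto simp: stable_maps_def image_image)
  from * show "inj_on (\<lambda>x. \<alpha> (\<beta> x)) A"
    using finite_A by (simp add: eq_card_imp_inj_on)
  show "x \<in> N \<Longrightarrow> \<alpha> (\<beta> x) \<in> A"
    using trans_in[OF \<open>\<beta> \<in> transformations n\<close>] by (blast intro: \<alpha>_in_A)
qed

lemma image_vm_A: "vm \<beta> \<gamma> ` A = \<gamma> ` (\<lambda>x. \<alpha> (\<beta> x)) ` A"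
  using A_subset by (force simp: variant_mult_apply image_image intro!: image_cong)

lemma stable_maps_closed:
  assumes "\<beta> \<in> stable_maps" "\<gamma> \<in> stable_maps"
  shows "vm \<beta> \<gamma> \<in> stable_maps"
  using assms stable_mapsD(2)[OF assms(1)]
  by (auto simp: stable_maps_def image_vm_A variant_closed)

text \<open>The map \<open>\<alpha> \<circ> \<beta>\<close> sends \<open>A\<close> into
  \<open>A\<close>. If \<open>\<alpha> \<circ> \<gamma>\<close> already covers \<open>A\<close>
  starting from that image, it does so starting from all of \<open>A\<close>.\<close>

lemma stable_maps_right_factor:
  assumes "\<beta> \<in> transformations n" "\<gamma> \<in> transformations n" "vm \<beta> \<gamma> \<in> stable_maps"
  shows "\<gamma> \<in> stable_maps"
proof -
  have "(\<lambda>x. \<alpha> (\<beta> x)) ` A \<subseteq> A"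
    using A_subset trans_in[OF assms(1)] by (blast intro: \<alpha>_in_A)
  moreover have "\<alpha> ` \<gamma> ` (\<lambda>x. \<alpha> (\<beta> x)) ` A = A"
    using assms(3) by (simp add: stable_maps_def image_vm_A)
  ultimately have "A \<subseteq> \<alpha> ` \<gamma> ` A"
    by (metis image_mono)
  moreover have "\<alpha> ` \<gamma> ` A \<subseteq> A"
    using A_subset trans_in[OF assms(2)] by (blast intro: \<alpha>_in_A)
  ultimately show ?thesis using assms(2) by (auto simp: stable_maps_def)
qed

sublocale stable: carrier_semigroup stable_maps vm
  by unfold_locales (auto simp: stable_maps_closed variant_assoc stable_mapsD(1))

text \<open>For \<open>j > 1\<close> the power has \<open>\<beta>\<close> as its last factor, so
  stability descends by \<open>stable_maps_right_factor\<close>; the converse is closure under the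
  product.\<close>

lemma spower_stable_iff:
  assumes "\<beta> \<in> transformations n" "j > 0"
  shows "spower vm \<beta> j \<in> stable_maps \<longleftrightarrow> \<beta> \<in> stable_maps"
proof
  assume L: "spower vm \<beta> j \<in> stable_maps"
  show "\<beta> \<in> stable_maps"
  proof (cases "j = 1")
    case False
    then obtain i where "j = Suc i" "i > 0"
      using assms(2) by (cases j) auto
    then show ?thesis
      using L assms stable_maps_right_factor[of "spower vm \<beta> i" \<beta>]
      by (simp add: spower_Suc variant.spower_closed)
  qed (use L in simp)
qed (use assms stable.spower_closed in blast)

text \<open>The values of \<open>\<alpha> \<circ> \<beta>\<close> lie in \<open>A\<close>, where
  \<open>\<alpha> \<circ> \<gamma>\<close> is injective, so the factor \<open>\<gamma>\<close>
  leaves the kernel alone. As \<open>\<alpha> \<circ> \<beta>\<close> maps \<open>A\<close> onto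
  itself, the factor \<open>\<beta>\<close> does not affect the image of \<open>A\<close>.\<close>

lemma coords_hom:
  assumes "\<beta> \<in> stable_maps" "\<gamma> \<in> stable_maps"
  shows "coords (vm \<beta> \<gamma>) = rect_mult (coords \<beta>) (coords \<gamma>)"
proof -
  have "ker_partition n (\<lambda>x. \<alpha> (vm \<beta> \<gamma> x)) = ker_partition n (\<lambda>x. \<alpha> (\<beta> x))"
  proof (rule ker_partition_cong)
    fix x y assume "x \<in> N" "y \<in> N"
    then show "\<alpha> (vm \<beta> \<gamma> x) = \<alpha> (vm \<beta> \<gamma> y) \<longleftrightarrow> \<alpha> (\<beta> x) = \<alpha> (\<beta> y)"
      using stable_mapsD(4)[OF assms(1)] inj_on_eq_iff[OF stable_mapsD(3)[OF assms(2)]]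
      by (simp add: variant_mult_apply)
  qed
  moreover have "vm \<beta> \<gamma> ` A = \<gamma> ` A"
    using stable_mapsD(2)[OF assms(1)] by (simp add: image_vm_A)
  ultimately show ?thesis by (simp add: coords_def rect_mult_def)
qed

text \<open>Picking one point from each kernel block amounts to picking one preimage under
  \<open>\<alpha>\<close> for each point of \<open>A\<close>. This replaces choice functions on
  blocks by a bijectivity condition.\<close>

lemma YY_iff: "I \<in> YY n \<alpha> \<longleftrightarrow> I \<subseteq> N \<and> bij_betw \<alpha> I A"
proof
  assume "I \<in> YY n \<alpha>"
  then obtain b where b: "I = b ` ker_partition n \<alpha>" "\<And>B. B \<in> ker_partition n \<alpha> \<Longrightarrow> b B \<in> B"
    by (auto simp: YY_def)
  have I: "I = (\<lambda>a. b {x \<in> N. \<alpha> x = a}) ` A"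
    by (simp only: b ker_partition_eq_image im_def image_image)
  have ba: "b {x \<in> N. \<alpha> x = a} \<in> N \<and> \<alpha> (b {x \<in> N. \<alpha> x = a}) = a" if "a \<in> A" for a
    using b(2)[of "{x \<in> N. \<alpha> x = a}"] that by (auto simp: ker_partition_eq_image im_def)
  show "I \<subseteq> N \<and> bij_betw \<alpha> I A"
  proof
    show "I \<subseteq> N" using ba unfolding I by blast
    show "bij_betw \<alpha> I A"
      by (rule bij_betw_byWitness[where f' = "\<lambda>a. b {x \<in> N. \<alpha> x = a}"]) (use ba I in auto)
  qed
next
  assume I: "I \<subseteq> N \<and> bij_betw \<alpha> I A"
  \<comment> \<open>The point of \<open>I\<close> in a block; it is unique since
    \<open>\<alpha>\<close> is constant on blocks and injective on \<open>I\<close>.\<close>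
  define b where "b B = (THE x. x \<in> I \<and> x \<in> B)" for B
  have b_eq: "b {y \<in> N. \<alpha> y = \<alpha> x} = x" if "x \<in> I" for x
    unfolding b_def using that I by (intro the_equality) (auto simp: bij_betw_def inj_on_def)
  have ker: "ker_partition n \<alpha> = (\<lambda>x. {y \<in> N. \<alpha> y = \<alpha> x}) ` I"
  proof -
    have "\<alpha> ` N = \<alpha> ` I" using I by (simp add: bij_betw_def im_def)
    then show ?thesis by (simp only: ker_partition_eq_image image_image)
  qed
  have "I = b ` ker_partition n \<alpha>"
    using b_eq by (force simp: ker image_image)
  moreover have "b B \<in> B" if "B \<in> ker_partition n \<alpha>" for B
    using that b_eq I by (auto simp: ker)
  ultimately show "I \<in> YY n \<alpha>" by (auto simp: YY_def)
qed

lemma card_YY: "I \<in> YY n \<alpha> \<Longrightarrow> card I = card A"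
  unfolding YY_iff by (blast intro: bij_betw_same_card)

text \<open>Since \<open>\<alpha> \<circ> \<beta>\<close> permutes \<open>A\<close>, its image is
  all of \<open>A\<close>, which gives the number of blocks, and it separates the points of
  \<open>A\<close>. The same injectivity makes \<open>\<alpha>\<close> injective on the image of
  \<open>A\<close> under \<open>\<beta>\<close>.\<close>

lemma coords_in:
  assumes "\<beta> \<in> stable_maps"
  shows "coords \<beta> \<in> XX n \<alpha> (card A) \<times> YY n \<alpha>"
proof -
  have "(\<lambda>x. \<alpha> (\<beta> x)) ` N = A"
    using stable_mapsD(2,4)[OF assms] A_subset by blast
  then have "ker_partition n (\<lambda>x. \<alpha> (\<beta> x)) \<in> XX n \<alpha> (card A)"
    using inj_on_eq_iff[OF stable_mapsD(3)[OF assms]]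
    unfolding XX_def mem_Collect_eq same_block_ker_partition
    by (auto simp: partition_on_ker_partition card_ker_partition simp del: One_nat_def)
  moreover have "\<beta> ` A \<subseteq> N"
    using A_subset trans_in[OF stable_mapsD(1)[OF assms]] by blast
  moreover have "bij_betw \<alpha> (\<beta> ` A) A"
    using stable_mapsD(2,3)[OF assms] by (fastforce simp: bij_betw_def inj_on_def image_image)
  ultimately show ?thesis by (simp add: coords_def YY_iff)
qed

text \<open>There are as many blocks as points of \<open>A\<close>, and these points lie in
  different blocks, so each block contains exactly one. The map \<open>r\<close> sends every point
  to the one in its block.\<close>

lemma XX_retraction:
  assumes "\<Lambda> \<in> XX n \<alpha> (card A)"
  obtains r where "\<And>x. x \<in> N \<Longrightarrow> r x \<in> A" "\<And>a. a \<in> A \<Longrightarrow> r a = a" "ker_partition n r = \<Lambda>"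
proof -
  have part: "partition_on N \<Lambda>" and card: "card \<Lambda> = card A"
    and sep: "\<And>a a' B. a \<in> A \<Longrightarrow> a' \<in> A \<Longrightarrow> B \<in> \<Lambda> \<Longrightarrow> a \<in> B \<Longrightarrow> a' \<in> B \<Longrightarrow> a = a'"
    using assms unfolding XX_def by blast+
  have \<Lambda>: "\<Union> \<Lambda> = N" "\<And>B C. B \<in> \<Lambda> \<Longrightarrow> C \<in> \<Lambda> \<Longrightarrow> B \<inter> C \<noteq> {} \<Longrightarrow> B = C"
    using part unfolding partition_on_def disjoint_def by blast+
  have "\<forall>x\<in>N. \<exists>B. B \<in> \<Lambda> \<and> x \<in> B" using \<Lambda>(1) by blast
  then obtain blk where blk: "\<And>x. x \<in> N \<Longrightarrow> blk x \<in> \<Lambda> \<and> x \<in> blk x"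
    by metis
  have blk_eq: "blk x = B" if "B \<in> \<Lambda>" "x \<in> B" for x B
  proof -
    have "x \<in> N" using that \<Lambda>(1) by blast
    with blk that show ?thesis by (intro \<Lambda>(2)) auto
  qed
  have "finite \<Lambda>"
    using \<Lambda>(1) by (metis finite_UnionD finite_atLeastAtMost)
  moreover have "inj_on blk A"
    using A_subset blk sep by (intro inj_onI) (metis subsetD)
  moreover have "blk ` A \<subseteq> \<Lambda>" using A_subset blk by blast
  \<comment> \<open>An injection into a finite set of the same cardinality is onto; the number of
    blocks enters here.\<close>
  ultimately have bij: "bij_betw blk A \<Lambda>"
    using card card_subset_eq[of \<Lambda> "blk ` A"] by (simp add: bij_betw_def card_image)
  define r where "r x = inv_into A blk (blk x)" for x
  show ?thesis
  proof
    show r_in: "r x \<in> A" if "x \<in> N" for x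
      using that blk bij unfolding r_def by (auto simp: bij_betw_def intro: inv_into_into)
    show r_A: "r a = a" if "a \<in> A" for a
      using that bij by (simp add: r_def bij_betw_def)
    have blk_r: "blk (r x) = blk x" if "x \<in> N" for x
      using that blk bij unfolding r_def by (auto simp: bij_betw_def f_inv_into_f)
    have "{x \<in> N. r x = a} = blk a" if "a \<in> A" for a
    proof (intro equalityI subsetI)
      fix x assume "x \<in> {x \<in> N. r x = a}"
      then show "x \<in> blk a" using blk blk_r by blast
    next
      fix x assume x: "x \<in> blk a"
      moreover have "blk a \<in> \<Lambda>" using that A_subset blk by blast
      ultimately have "blk x = blk a" "x \<in> N" using blk_eq \<Lambda>(1) by blast+
      then show "x \<in> {x \<in> N. r x = a}"
        using r_A[OF that] by (simp add: r_def)
    qed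
    moreover have "r ` N = A"
      using r_in r_A A_subset by (metis image_subsetI image_eqI subsetD subsetI subset_antisym)
    ultimately have "ker_partition n r = blk ` A"
      by (simp only: ker_partition_eq_image cong: image_cong)
    also have "\<dots> = \<Lambda>" using bij by (simp add: bij_betw_def)
    finally show "ker_partition n r = \<Lambda>" .
  qed
qed

text \<open>The preimage is \<open>s \<circ> r\<close>, with \<open>r\<close> the retraction
  attached to \<open>\<Lambda>\<close> and \<open>s\<close> the section of \<open>\<alpha>\<close>
  over \<open>A\<close> with image \<open>I\<close>. Composing it with \<open>\<alpha>\<close> gives
  back \<open>r\<close>, which is the identity on \<open>A\<close>.\<close>

lemma coords_surj:
  assumes "\<Lambda> \<in> XX n \<alpha> (card A)" "I \<in> YY n \<alpha>"
  obtains \<beta> where "\<beta> \<in> stable_maps" "coords \<beta> = (\<Lambda>, I)"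
proof -
  obtain r where r: "\<And>x. x \<in> N \<Longrightarrow> r x \<in> A" "\<And>a. a \<in> A \<Longrightarrow> r a = a" "ker_partition n r = \<Lambda>"
    using XX_retraction[OF assms(1)] by blast
  define s where "s = inv_into I \<alpha>"
  have I: "I \<subseteq> N" "bij_betw \<alpha> I A" using assms(2) by (simp_all add: YY_iff)
  have s: "\<alpha> (s a) = a" "s a \<in> N" if "a \<in> A" for a
    using that I bij_betw_inv_into_right[OF I(2)] inv_into_into[of a \<alpha> I]
    by (auto simp: s_def bij_betw_def simp del: atLeastAtMost_iff)
  have sA: "s ` A = I"
    using bij_betw_inv_into[OF I(2)] by (simp add: s_def bij_betw_def)
  \<comment> \<open>Restriction supplies the default value outside \<open>N\<close> that extensional
    maps must take.\<close>
  define \<beta> where "\<beta> = restrict (\<lambda>x. s (r x)) N"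
  have \<beta>A: "\<beta> a = s a" if "a \<in> A" for a
    using that A_subset r(2) by (auto simp: \<beta>_def)
  have "\<beta> \<in> transformations n"
    using s r by (auto simp: \<beta>_def transformations_def simp del: atLeastAtMost_iff)
  moreover have "\<alpha> ` \<beta> ` A = A"
    using s \<beta>A by (simp add: image_image)
  moreover have "ker_partition n (\<lambda>x. \<alpha> (\<beta> x)) = ker_partition n r"
    by (rule ker_partition_cong) (simp add: \<beta>_def s r del: atLeastAtMost_iff)
  moreover have "\<beta> ` A = I"
    using \<beta>A sA by simp
  ultimately show ?thesis
    using that[of \<beta>] r by (simp add: stable_maps_def coords_def)
qed

section \<open>Idempotents among the stable maps\<close>

lemma variant_idempotent_apply:
  assumes "variant_idempotent n \<alpha> \<epsilon>" "x \<in> N"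
  shows "\<epsilon> (\<alpha> (\<epsilon> x)) = \<epsilon> x"
  using assms variant_mult_apply[of n \<alpha> \<epsilon> \<epsilon> x] by (simp add: variant_idempotent_def)

text \<open>On \<open>A\<close> the map \<open>\<alpha> \<circ> \<epsilon>\<close> is both
  idempotent and injective, and such a map is the identity.\<close>

lemma stable_idempotent_fixes_A:
  assumes "variant_idempotent n \<alpha> \<epsilon>" "\<epsilon> \<in> stable_maps" "a \<in> A"
  shows "\<alpha> (\<epsilon> a) = a"
proof -
  have "a \<in> N" using assms A_subset by blast
  then have "\<alpha> (\<epsilon> (\<alpha> (\<epsilon> a))) = \<alpha> (\<epsilon> a)"
    using variant_idempotent_apply[OF assms(1)] by simp
  then show ?thesis
    using inj_onD[OF stable_mapsD(3)[OF assms(2)]] stable_mapsD(4)[OF assms(2) \<open>a \<in> N\<close>] assms(3)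
    by blast
qed

text \<open>Idempotence recovers \<open>\<epsilon> x\<close> from
  \<open>\<alpha> (\<epsilon> x)\<close>, so composing with \<open>\<alpha>\<close> merges no
  blocks. It also shows that the value \<open>\<epsilon> x\<close> is attained at the point
  \<open>\<alpha> (\<epsilon> x)\<close> of \<open>A\<close>.\<close>

lemma coords_idempotent:
  assumes "variant_idempotent n \<alpha> \<epsilon>" "\<epsilon> \<in> stable_maps"
  shows "coords \<epsilon> = (ker_partition n \<epsilon>, im n \<epsilon>)"
proof -
  have "ker_partition n (\<lambda>x. \<alpha> (\<epsilon> x)) = ker_partition n \<epsilon>"
    using variant_idempotent_apply[OF assms(1)] by (intro ker_partition_cong) metis
  moreover have "\<epsilon> ` N \<subseteq> \<epsilon> ` A"
    using variant_idempotent_apply[OF assms(1)] stable_mapsD(4)[OF assms(2)]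
    by (metis image_subsetI image_eqI)
  ultimately show ?thesis
    using A_subset by (auto simp: coords_def im_def)
qed

text \<open>The image of a stable idempotent is a transversal of the kernel of
  \<open>\<alpha>\<close>. Conversely, an idempotent \<open>\<epsilon>\<close> maps the
  \<open>\<alpha>\<close>-image of \<open>im n \<epsilon>\<close> onto
  \<open>im n \<epsilon>\<close>, so for rank \<open>card A\<close> this subset of \<open>A\<close>
  is large enough to be all of \<open>A\<close>.\<close>

lemma stable_idempotent_iff:
  assumes "variant_idempotent n \<alpha> \<epsilon>"
  shows "\<epsilon> \<in> stable_maps \<longleftrightarrow> rank n \<epsilon> = card A"
proof
  assume "\<epsilon> \<in> stable_maps"
  then have "im n \<epsilon> \<in> YY n \<alpha>"
    using coords_idempotent[OF assms] coords_in by fastforce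
  then show "rank n \<epsilon> = card A"
    by (simp add: rank_def card_YY)
next
  assume rank: "rank n \<epsilon> = card A"
  have \<epsilon>: "\<epsilon> \<in> transformations n" using assms by (simp add: variant_idempotent_def)
  have sub: "\<alpha> ` im n \<epsilon> \<subseteq> A"
    using trans_in[OF \<epsilon>] unfolding im_def[of n \<epsilon>] by (blast intro: \<alpha>_in_A)
  have "im n \<epsilon> \<subseteq> \<epsilon> ` \<alpha> ` im n \<epsilon>"
    unfolding im_def[of n \<epsilon>] using variant_idempotent_apply[OF assms]
    by (metis image_eqI image_subsetI)
  then have "card (im n \<epsilon>) \<le> card (\<alpha> ` im n \<epsilon>)"
    using surj_card_le[of "\<alpha> ` im n \<epsilon>" "im n \<epsilon>" \<epsilon>] by (simp add: im_def)
  then have eq: "\<alpha> ` im n \<epsilon> = A"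
    using rank sub by (intro card_seteq finite_A) (simp_all add: rank_def)
  have "im n \<epsilon> \<subseteq> \<epsilon> ` A"
    using \<open>im n \<epsilon> \<subseteq> \<epsilon> ` \<alpha> ` im n \<epsilon>\<close> eq by simp
  moreover have "\<epsilon> ` A \<subseteq> im n \<epsilon>"
    using A_subset by (auto simp: im_def)
  ultimately have "\<alpha> ` \<epsilon> ` A = A" using eq by (metis subset_antisym)
  then show "\<epsilon> \<in> stable_maps" using \<epsilon> by (simp add: stable_maps_def)
qed

text \<open>On \<open>A\<close> the value \<open>\<epsilon> a\<close> is forced to be the point of
  the transversal over \<open>a\<close>. Any other point takes the value of the point of
  \<open>A\<close> in its kernel block.\<close>

lemma stable_idempotent_unique:
  assumes "variant_idempotent n \<alpha> \<epsilon>" "\<epsilon> \<in> stable_maps"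
    and "variant_idempotent n \<alpha> \<delta>" "\<delta> \<in> stable_maps"
    and "coords \<epsilon> = coords \<delta>"
  shows "\<epsilon> = \<delta>"
proof (rule trans_eqI)
  show "\<epsilon> \<in> transformations n" "\<delta> \<in> transformations n"
    using assms stable_mapsD(1) by blast+
  have on_A: "\<epsilon> a = \<delta> a" if "a \<in> A" for a
  proof -
    have "inj_on \<alpha> (\<epsilon> ` A)"
      using coords_in[OF assms(2)] by (simp add: coords_def YY_iff bij_betw_def)
    moreover have "\<epsilon> a \<in> \<epsilon> ` A" "\<delta> a \<in> \<epsilon> ` A"
      using that assms(5) by (auto simp: coords_def)
    moreover have "\<alpha> (\<epsilon> a) = \<alpha> (\<delta> a)"
      using that assms stable_idempotent_fixes_A by simp
    ultimately show ?thesis by (metis inj_onD)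
  qed
  fix x assume x: "x \<in> N"
  \<comment> \<open>This is the point of \<open>A\<close> in the kernel block of \<open>x\<close>,
    because \<open>\<alpha> \<circ> \<epsilon>\<close> fixes it.\<close>
  define a where "a = \<alpha> (\<epsilon> x)"
  have a: "a \<in> A" using stable_mapsD(4)[OF assms(2) x] by (simp add: a_def)
  have "\<alpha> (\<epsilon> x) = \<alpha> (\<epsilon> a)"
    using stable_idempotent_fixes_A[OF assms(1,2) a] by (simp add: a_def)
  then have "\<alpha> (\<delta> x) = \<alpha> (\<delta> a)"
    using ker_partition_eqD[of n "\<lambda>x. \<alpha> (\<epsilon> x)" "\<lambda>x. \<alpha> (\<delta> x)" x a] assms(5) x a A_subset
    by (auto simp: coords_def)
  then have "\<alpha> (\<delta> x) = a"
    using stable_idempotent_fixes_A[OF assms(3,4) a] by simp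
  then show "\<epsilon> x = \<delta> x"
    using variant_idempotent_apply[OF assms(1) x] variant_idempotent_apply[OF assms(3) x]
      on_A[OF a] by (simp add: a_def)
qed

text \<open>After this, parts (b) to (d) are instances of the general results, once stable rank,
  roots and the natural projection are expressed through \<open>coords\<close>.\<close>

sublocale coords: rect_band_hom stable_maps vm coords "XX n \<alpha> (card A)" "YY n \<alpha>"
proof unfold_locales
  show "finite stable_maps"
    using finite_transformations by (simp add: stable_maps_def)
  show "coords ` stable_maps = XX n \<alpha> (card A) \<times> YY n \<alpha>"
  proof (intro equalityI subsetI)
    fix p assume "p \<in> XX n \<alpha> (card A) \<times> YY n \<alpha>"
    then show "p \<in> coords ` stable_maps"
      by (auto elim!: SigmaE coords_surj intro: rev_image_eqI)
  qed (use coords_in in blast)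
  show "x = y" if "x \<in> stable_maps" "y \<in> stable_maps" "vm x x = x" "vm y y = y"
    "coords x = coords y" for x y
    using that by (intro stable_idempotent_unique) (simp_all add: variant_idempotent_def stable_mapsD)
qed (rule coords_hom)

section \<open>Stable rank, roots and the natural projection\<close>

lemma idempotent_power_exists:
  assumes "\<beta> \<in> transformations n"
  obtains j where "j > 0" "variant_idempotent n \<alpha> (spower vm \<beta> j)"
  using variant.idempotent_spower_exists[OF finite_transformations assms]
    variant.spower_closed[OF assms] unfolding variant_idempotent_def by metis

text \<open>The description in \<open>stable_rank\<close> denotes the idempotent power of
  \<open>\<beta>\<close>. That power has rank \<open>card A\<close> iff it is stable, hence iff
  \<open>\<beta>\<close> is stable.\<close>

lemma stable_rank_set_eq: "stable_rank_set n \<alpha> (card A) = stable_maps"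
proof -
  have "stable_rank n \<alpha> \<beta> = card A \<longleftrightarrow> \<beta> \<in> stable_maps" if \<beta>: "\<beta> \<in> transformations n" for \<beta>
  proof -
    obtain j where j: "j > 0" "variant_idempotent n \<alpha> (spower vm \<beta> j)"
      using idempotent_power_exists[OF \<beta>] .
    have "(THE \<epsilon>. \<epsilon> \<in> cyclic_subsemigroup vm \<beta> \<and> variant_idempotent n \<alpha> \<epsilon>) = spower vm \<beta> j"
      using j variant.idempotent_spower_unique[OF \<beta>]
      by (intro the_equality) (auto simp: cyclic_subsemigroup_def variant_idempotent_def)
    then show ?thesis
      using stable_idempotent_iff[OF j(2)] spower_stable_iff[OF \<beta> j(1)]
      by (simp add: stable_rank_def)
  qed
  then show ?thesis
    using stable_mapsD(1) by (auto simp: stable_rank_set_def)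
qed

text \<open>The description in \<open>idem\<close> has to be shown well defined. A witness is the
  idempotent power of any \<open>\<beta>\<close> over \<open>p\<close>; uniqueness is that of stable
  idempotents with given coordinates.\<close>

lemma idem_stable:
  assumes "p \<in> XX n \<alpha> (card A) \<times> YY n \<alpha>"
  shows "variant_idempotent n \<alpha> (idem n \<alpha> (fst p) (snd p))" (is "variant_idempotent n \<alpha> ?\<epsilon>")
    and "idem n \<alpha> (fst p) (snd p) \<in> stable_maps"
    and "coords (idem n \<alpha> (fst p) (snd p)) = p"
proof -
  obtain \<beta> where \<beta>: "\<beta> \<in> stable_maps" "coords \<beta> = p"
    using assms coords.surj by (metis imageE)
  obtain j where j: "j > 0" "variant_idempotent n \<alpha> (spower vm \<beta> j)"
    using idempotent_power_exists[OF stable_mapsD(1)[OF \<beta>(1)]] .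
  \<comment> \<open>For idempotents, the prescribed image already forces stability, because a
    transversal has \<open>card A\<close> points.\<close>
  have iff: "ker_partition n \<epsilon> = fst p \<and> im n \<epsilon> = snd p \<longleftrightarrow> \<epsilon> \<in> stable_maps \<and> coords \<epsilon> = p"
    if "variant_idempotent n \<alpha> \<epsilon>" for \<epsilon>
  proof
    assume *: "ker_partition n \<epsilon> = fst p \<and> im n \<epsilon> = snd p"
    then have "rank n \<epsilon> = card A"
      using assms by (auto simp: rank_def card_YY)
    then show "\<epsilon> \<in> stable_maps \<and> coords \<epsilon> = p"
      using stable_idempotent_iff[OF that] coords_idempotent[OF that] * by simp
  qed (use coords_idempotent[OF that] in auto)
  have "\<exists>!\<epsilon>. variant_idempotent n \<alpha> \<epsilon> \<and> ker_partition n \<epsilon> = fst p \<and> im n \<epsilon> = snd p"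
  proof (rule ex1I[of _ "spower vm \<beta> j"])
    show "variant_idempotent n \<alpha> (spower vm \<beta> j) \<and> ker_partition n (spower vm \<beta> j) = fst p
        \<and> im n (spower vm \<beta> j) = snd p"
      using j \<beta> iff[OF j(2)] by (simp add: stable.spower_closed coords.hom_spower)
    fix \<epsilon> assume "variant_idempotent n \<alpha> \<epsilon> \<and> ker_partition n \<epsilon> = fst p \<and> im n \<epsilon> = snd p"
    then have "variant_idempotent n \<alpha> \<epsilon>" "\<epsilon> \<in> stable_maps" "coords \<epsilon> = p"
      using iff by blast+
    then show "\<epsilon> = spower vm \<beta> j"
      using j \<beta> by (intro stable_idempotent_unique)
        (simp_all add: stable.spower_closed coords.hom_spower)
  qed
  from theI'[OF this, folded idem_def] show "variant_idempotent n \<alpha> ?\<epsilon>"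
    and "?\<epsilon> \<in> stable_maps" and "coords ?\<epsilon> = p"
    using iff by blast+
qed

text \<open>A root of the idempotent is stable because one of its powers is, and then has the same
  coordinates. Conversely, the idempotent power of a stable map over \<open>p\<close> must be the
  unique stable idempotent there.\<close>

lemma root_class_eq:
  assumes p: "p \<in> XX n \<alpha> (card A) \<times> YY n \<alpha>"
  shows "root_class n \<alpha> p = {\<beta> \<in> stable_maps. coords \<beta> = p}"
proof (intro equalityI subsetI)
  fix \<beta> assume "\<beta> \<in> root_class n \<alpha> p"
  then obtain j where \<beta>: "\<beta> \<in> transformations n" and j: "j > 0"
    "spower vm \<beta> j = idem n \<alpha> (fst p) (snd p)"
    by (auto simp: root_class_def variant_sqrt_def)
  then have "\<beta> \<in> stable_maps"
    using idem_stable(2)[OF p] spower_stable_iff[OF \<beta> j(1)] by simp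
  moreover from this have "coords \<beta> = p"
    using coords.hom_spower[of \<beta> j] j idem_stable(3)[OF p] by simp
  ultimately show "\<beta> \<in> {\<beta> \<in> stable_maps. coords \<beta> = p}" by simp
next
  fix \<beta> assume "\<beta> \<in> {\<beta> \<in> stable_maps. coords \<beta> = p}"
  then have \<beta>: "\<beta> \<in> stable_maps" "coords \<beta> = p" by simp_all
  obtain j where j: "j > 0" "variant_idempotent n \<alpha> (spower vm \<beta> j)"
    using idempotent_power_exists[OF stable_mapsD(1)[OF \<beta>(1)]] .
  have "spower vm \<beta> j = idem n \<alpha> (fst p) (snd p)"
    using j \<beta> idem_stable[OF p]
    by (intro stable_idempotent_unique) (simp_all add: stable.spower_closed coords.hom_spower)
  then show "\<beta> \<in> root_class n \<alpha> p"
    using j(1) stable_mapsD(1)[OF \<beta>(1)] by (auto simp: root_class_def variant_sqrt_def)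
qed

lemma root_rel_eq: "root_rel n \<alpha> (card A) = coords.fibre_rel"
  using coords_in by (auto simp: root_rel_def coords.fibre_rel_def root_class_eq)

lemma natural_proj_eq:
  assumes "\<beta> \<in> stable_maps"
  shows "natural_proj n \<alpha> (card A) \<beta> = coords \<beta>"
  unfolding natural_proj_def using assms coords_in[OF assms]
  by (intro the_equality) (auto simp: root_class_eq)

end

theorem proposition11:
  fixes n l :: nat and \<alpha> :: "nat \<Rightarrow> nat"
  assumes "n \<ge> 1"
    and "\<alpha> \<in> transformations n"
    and "tmult n \<alpha> \<alpha> = \<alpha>"
    and "rank n \<alpha> = l"
  shows
    "subsemigroup (transformations n) (variant_mult n \<alpha>) (stable_rank_set n \<alpha> l)
   \<and> (stable_rank_set n \<alpha> l = (\<Union>p \<in> XX n \<alpha> l \<times> YY n \<alpha>. root_class n \<alpha> p)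
      \<and> disjoint_family_on (root_class n \<alpha>) (XX n \<alpha> l \<times> YY n \<alpha>)
      \<and> congruence_on (stable_rank_set n \<alpha> l) (variant_mult n \<alpha>) (root_rel n \<alpha> l)
      \<and> semigroup_isomorphic
          (stable_rank_set n \<alpha> l // root_rel n \<alpha> l)
          (quotient_mult (variant_mult n \<alpha>) (root_rel n \<alpha> l))
          (XX n \<alpha> l \<times> YY n \<alpha>) rect_mult)
   \<and> bij_betw (\<lambda>T. natural_proj n \<alpha> l -` T \<inter> stable_rank_set n \<alpha> l)
        {T. subsemigroup (XX n \<alpha> l \<times> YY n \<alpha>) rect_mult T}
        (isolated_subsemigroups (stable_rank_set n \<alpha> l) (variant_mult n \<alpha>))
   \<and> int (card (isolated_subsemigroups (stable_rank_set n \<alpha> l) (variant_mult n \<alpha>))) =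
        2 ^ (card (XX n \<alpha> l) + card (YY n \<alpha>)) - 2 ^ card (XX n \<alpha> l) - 2 ^ card (YY n \<alpha>) + 1"
proof -
  interpret idempotent_transformation n \<alpha>
    using assms by unfold_locales
  have l: "l = card (im n \<alpha>)" using assms by (simp add: rank_def)
  have S: "stable_rank_set n \<alpha> l = stable_maps" by (simp add: l stable_rank_set_eq)
  \<comment> \<open>The map \<open>\<alpha>\<close> is itself stable, which gives the non-emptiness
    required of a subsemigroup.\<close>
  have "\<alpha> ` A = A" using \<alpha>_fixes_A by simp
  then have "\<alpha> \<in> stable_maps"
    using \<alpha>_trans by (simp add: stable_maps_def)
  then have a: "subsemigroup (transformations n) (variant_mult n \<alpha>) (stable_rank_set n \<alpha> l)"
    unfolding S using stable_maps_closed stable_mapsD(1) by (auto simp: subsemigroup_def)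
  have classes: "root_class n \<alpha> p = {\<beta> \<in> stable_maps. coords \<beta> = p}"
    if "p \<in> XX n \<alpha> l \<times> YY n \<alpha>" for p
    using that root_class_eq by (simp add: l)
  have union: "stable_rank_set n \<alpha> l = (\<Union>p \<in> XX n \<alpha> l \<times> YY n \<alpha>. root_class n \<alpha> p)"
  proof -
    have "stable_maps = (\<Union>p\<in>coords ` stable_maps. {\<beta> \<in> stable_maps. coords \<beta> = p})" by blast
    also have "\<dots> = (\<Union>p \<in> XX n \<alpha> l \<times> YY n \<alpha>. root_class n \<alpha> p)"
      using classes by (intro SUP_cong) (simp_all only: coords.surj l)
    finally show ?thesis by (simp only: S)
  qed
  have disjoint: "disjoint_family_on (root_class n \<alpha>) (XX n \<alpha> l \<times> YY n \<alpha>)"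
  proof (unfold disjoint_family_on_def, intro ballI impI)
    fix p q assume "p \<in> XX n \<alpha> l \<times> YY n \<alpha>" "q \<in> XX n \<alpha> l \<times> YY n \<alpha>" "p \<noteq> q"
    then show "root_class n \<alpha> p \<inter> root_class n \<alpha> q = {}"
      by (auto simp only: classes)
  qed
  \<comment> \<open>Off \<open>stable_maps\<close> the description in \<open>natural_proj\<close>
    has no intended value, so the two maps are compared only there.\<close>
  have "natural_proj n \<alpha> l -` T \<inter> stable_maps = coords -` T \<inter> stable_maps" for T
    using natural_proj_eq by (auto simp: l)
  then have c: "bij_betw (\<lambda>T. natural_proj n \<alpha> l -` T \<inter> stable_rank_set n \<alpha> l)
        {T. subsemigroup (XX n \<alpha> l \<times> YY n \<alpha>) rect_mult T}
        (isolated_subsemigroups (stable_rank_set n \<alpha> l) (variant_mult n \<alpha>))"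
    using coords.bij_betw_isolated unfolding S by (simp add: l)
  show ?thesis
    using coords.congruence_fibre_rel coords.quotient_fibre_rel_isomorphic
      coords.card_isolated_subsemigroups
    by (intro conjI a union disjoint c) (simp_all only: l stable_rank_set_eq root_rel_eq)
qed

end
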